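(* Let $C_1,\Omega_1,C_2,\Omega_2\in\mathbb R^{m\times m}$ satisfy $C_1+\Omega_1=C_2+\Omega_2$. Let $(x_t^{(1)},\mu_t^{(1)})$ be generated by $ALG(C_1,\Omega_1)$ and $(x_t^{(2)},\mu_t^{(2)})$ by $ALG(C_2,\Omega_2)$, with the same $f$, $h$, $\eta_x$, $\eta_{\rm d}$. Suppose their primal histories and effective dual variables are initialized consistently, i.e. $x_{-1}^{(1)}=x_{-1}^{(2)}$, $x_0^{(1)}=x_0^{(2)}$, and $$\mu_0^{(1)}+C_1h(x_{-1}^{(1)})=\mu_0^{(2)}+C_2h(x_{-1}^{(2)}).$$ Then the two methods generate identical primal trajectories: $x_t^{(1)}=x_t^{(2)}$ for all $t\ge 0$.
   Context: Let $f:\mathbb R^d\to\mathbb R$ and $h:\mathbb R^d\to\mathbb R^m$ be differentiable, with Jacobian $J_h(x)\in\mathbb R^{m\times d}$, and fix step sizes $\eta_x>0$, $\eta_{\rm d}>0$. For matrices $C,\Omega\in\mathbb R^{m\times m}$, the hybrid method $ALG(C,\Omega)$, started from given $x_{-1},x_0\in\mathbb R^d$ and $\mu_0\in\mathbb R^m$, is the iteration, for $t\ge 0$, $$\mu_{t+1}=\mu_t+\eta_{\rm d}h(x_t)+\Omega\big(h(x_t)-h(x_{t-1})\big),$$ $$x_{t+1}=x_t-\eta_x\Big[\nabla f(x_t)+J_h(x_t)^\top\big(\mu_{t+1}+C\,h(x_t)\big)\Big].$$ The effective dual variable of $ALG(C,\Omega)$ is $\nu_t:=\mu_t+C\,h(x_{t-1})$.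 *)

theory Defs
  imports "HOL-Analysis.Analysis"
begin

definition gradient :: "('a::real_inner \<Rightarrow> real) \<Rightarrow> 'a \<Rightarrow> 'a"
  where "gradient f x = (THE D. GDERIV f x :> D)"

lemma GDERIV_gradient:
  fixes f :: "'a::euclidean_space \<Rightarrow> real"
  assumes "f differentiable (at x)"
  shows "GDERIV f x :> gradient f x"
proof -
  obtain f' where f': "(f has_derivative f') (at x)"
    using assms unfolding differentiable_def by blast
  have lin: "linear f'"
    using f' by (rule has_derivative_linear)
  define D where "D = adjoint f' 1"
  have "inner h D = f' h" for h
    unfolding D_def using adjoint_works[OF lin, of h 1] by simp
  then have D: "GDERIV f x :> D"
    using f' by (simp add: gderiv_def)
  moreover have "E = D" if "GDERIV f x :> E" for E
  proof -
    have "(\<lambda>h. inner h E) = (\<lambda>h. inner h D)"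
      using that D has_derivative_unique unfolding gderiv_def by blast
    then have "\<forall>h. inner h E = inner h D"
      by meson
    then show "E = D"
      by (simp add: vector_eq_ldot)
  qed
  ultimately show ?thesis
    unfolding gradient_def by (rule theI)
qed

text \<open>
  Iterates are indexed by integers because the primal sequence starts at time \<open>-1\<close>.
  The predicate constrains \<open>x\<close> at times \<open>\<ge> -1\<close> and \<open>\<mu>\<close> at times \<open>\<ge> 0\<close> only; the values
  \<open>x (-1)\<close>, \<open>x 0\<close> and \<open>\<mu> 0\<close> are the free initial data.
\<close>

definition hybrid_alg ::
  "(real^'d \<Rightarrow> real) \<Rightarrow> (real^'d \<Rightarrow> real^'m) \<Rightarrow> real \<Rightarrow> real \<Rightarrow> real^'m^'m \<Rightarrow> real^'m^'m
    \<Rightarrow> (int \<Rightarrow> real^'d) \<Rightarrow> (int \<Rightarrow> real^'m) \<Rightarrow> bool"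
  where "hybrid_alg f h \<eta>x \<eta>d C \<Omega> x \<mu> \<longleftrightarrow>
    (\<forall>t\<ge>0.
      \<mu> (t + 1) = \<mu> t + \<eta>d *\<^sub>R h (x t) + \<Omega> *v (h (x t) - h (x (t - 1))) \<and>
      x (t + 1) = x t - \<eta>x *\<^sub>R
        (gradient f (x t) + transpose (jacobian h (at (x t))) *v (\<mu> (t + 1) + C *v h (x t))))"

definition effective_dual ::
  "(real^'d \<Rightarrow> real^'m) \<Rightarrow> real^'m^'m \<Rightarrow> (int \<Rightarrow> real^'d) \<Rightarrow> (int \<Rightarrow> real^'m) \<Rightarrow> int \<Rightarrow> real^'m"
  where "effective_dual h C x \<mu> t = \<mu> t + C *v h (x (t - 1))"

end

theory Submission
  imports Defs
begin

text \<open>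
  In terms of the effective dual variable \<open>\<nu>\<close>, the iteration reads
  \<open>\<nu> (t + 1) = \<nu> t + \<eta>d h (x t) + (C + \<Omega>) (h (x t) - h (x (t - 1)))\<close>, and the primal step uses
  only \<open>x t\<close> and \<open>\<nu> (t + 1)\<close>. So \<open>C\<close> and \<open>\<Omega>\<close> enter only through their sum.
\<close>

lemma hybrid_alg_effective_dual_step:
  assumes "hybrid_alg f h \<eta>x \<eta>d C \<Omega> x \<mu>" and "t \<ge> 0"
  shows "effective_dual h C x \<mu> (t + 1) = effective_dual h C x \<mu> t + \<eta>d *\<^sub>R h (x t)
    + (C + \<Omega>) *v (h (x t) - h (x (t - 1)))"
proof -
  have "\<mu> (t + 1) = \<mu> t + \<eta>d *\<^sub>R h (x t) + \<Omega> *v (h (x t) - h (x (t - 1)))"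
    using assms unfolding hybrid_alg_def by blast
  \<comment> \<open>Passing from \<open>t\<close> to \<open>t + 1\<close> changes the correction
    term of \<nu> by \<open>C *v (h (x t) - h (x (t - 1)))\<close>, which merges with the
    \<open>\<Omega>\<close> term.\<close>
  then show ?thesis
    by (simp add: effective_dual_def matrix_vector_mult_add_rdistrib matrix_vector_mult_diff_distrib)
qed

text \<open>The index shift in \<open>effective_dual\<close> makes its value at \<open>t + 1\<close>
  use \<open>h (x t)\<close>, exactly the multiplier in the primal update.\<close>

lemma hybrid_alg_primal_step:
  assumes "hybrid_alg f h \<eta>x \<eta>d C \<Omega> x \<mu>" and "t \<ge> 0"
  shows "x (t + 1) = x t - \<eta>x *\<^sub>R
    (gradient f (x t) + transpose (jacobian h (at (x t))) *v effective_dual h C x \<mu> (t + 1))"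
  using assms unfolding hybrid_alg_def effective_dual_def by simp

theorem corollary1:
  fixes f :: "real^'d \<Rightarrow> real" and h :: "real^'d \<Rightarrow> real^'m"
    and \<eta>x \<eta>d :: real
    and C1 \<Omega>1 C2 \<Omega>2 :: "real^'m^'m"
    and x1 x2 :: "int \<Rightarrow> real^'d" and \<mu>1 \<mu>2 :: "int \<Rightarrow> real^'m"
  assumes "\<And>y. f differentiable (at y)" and "\<And>y. h differentiable (at y)"
    and "\<eta>x > 0" and "\<eta>d > 0"
    and "C1 + \<Omega>1 = C2 + \<Omega>2"
    and "hybrid_alg f h \<eta>x \<eta>d C1 \<Omega>1 x1 \<mu>1"
    and "hybrid_alg f h \<eta>x \<eta>d C2 \<Omega>2 x2 \<mu>2"
    and "x1 (-1) = x2 (-1)" and "x1 0 = x2 0"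
    and "effective_dual h C1 x1 \<mu>1 0 = effective_dual h C2 x2 \<mu>2 0"
  shows "\<forall>t\<ge>0. x1 t = x2 t"
proof (intro allI impI)
  \<comment> \<open>The dual recursion looks back two primal iterates, so the invariant carries both
    along with \<nu>.\<close>
  have "x1 (t - 1) = x2 (t - 1) \<and> x1 t = x2 t \<and>
      effective_dual h C1 x1 \<mu>1 t = effective_dual h C2 x2 \<mu>2 t" if "t \<ge> 0" for t
    using that
  proof (induction t rule: int_ge_induct)
    case base
    show ?case
      using assms(8-10) by simp
  next
    case (step t)
    have "effective_dual h C1 x1 \<mu>1 (t + 1) = effective_dual h C2 x2 \<mu>2 (t + 1)"
      using hybrid_alg_effective_dual_step[OF assms(6) step.hyps]
        hybrid_alg_effective_dual_step[OF assms(7) step.hyps] step.IH assms(5) by simp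
    \<comment> \<open>The dual equality has to come first: the primal step at \<open>t\<close>
      already uses \<nu> at \<open>t + 1\<close>.\<close>
    moreover from this have "x1 (t + 1) = x2 (t + 1)"
      using hybrid_alg_primal_step[OF assms(6) step.hyps]
        hybrid_alg_primal_step[OF assms(7) step.hyps] step.IH by simp
    ultimately show ?case
      using step.IH by simp
  qed
  then show "x1 t = x2 t" if "t \<ge> 0" for t
    using that by blast
qed

end
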